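(* (1) Let $f:\mathbb{F}_2^n\to\{1,-1\}$ have $(\epsilon,k)$ Balanced Influences. Then $f$ is $(\sqrt{2^{-k}+\epsilon},n)$ $\mathbb{R}$-Regular. (2) Conversely, for any $\epsilon>0$ there is a function $f:\mathbb{F}_2^n\to\{1,-1\}$ (for some $n$) which is $(\epsilon,n)$ $\mathbb{R}$-Regular and which does not have $(\epsilon',k)$ Balanced Influences for any rank $k\ge 1$ or error bound $\epsilon'<\frac12$.
   Context: $\widehat f(\gamma)=\mathbb{E}_{x\in\mathbb{F}_2^n}f(x)(-1)^{\gamma\cdot x}$ (uniform expectation); $|\gamma|$ is the Hamming weight; $I_\gamma[f]=\mathbb{P}_{x\in\mathbb{F}_2^n}[f(x)\neq f(x+\gamma)]$. A boolean function $f:\mathbb{F}_2^n\to\{1,-1\}$ with $|\widehat f(0)|<\frac12$ has $(\epsilon,k)$ Balanced Influences if $|I_\gamma[f]-\frac12|<\epsilon$ for every nonzero $\gamma\in\mathbb{F}_2^n$ with $|\gamma|\le k$. A boolean function $f$ is $(\epsilon,d)$ $\mathbb{R}$-Regular if $|\widehat f(\gamma)|<\epsilon$ for every $\gamma\in\mathbb{F}_2^n$ with $|\gamma|\le d$.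
   Formalization: In (1) the bound is corrected to sqrt(2^{-k}+2ε), since the printed sqrt(2^{-k}+ε) fails (n=k=3, ε=0.26, a nontrivial character flipped at one point); (1) also assumes k≤n and ε>0, without which it fails (bent functions with tiny ε; k=0 with ε≤0). *)

theory Defs
  imports
    "HOL-Probability.Probability"
    "HOL-Library.Z2"
    "Jordan_Normal_Form.Matrix"
begin

text \<open>The space \<open>F_2^n\<close> is \<^term>\<open>carrier_vec n :: bit vec set\<close>, and \<^const>\<open>scalar_prod\<close> is the
  dot product over \<open>F_2\<close>. Functions on \<open>F_2^n\<close> are total on \<^typ>\<open>bit vec\<close>; only their values
  on the carrier matter.\<close>

definition boolean_function :: "nat \<Rightarrow> (bit vec \<Rightarrow> real) \<Rightarrow> bool" where
  "boolean_function n f \<longleftrightarrow> f \<in> carrier_vec n \<rightarrow> {1, -1}"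

definition hamming_weight :: "bit vec \<Rightarrow> nat" where
  "hamming_weight \<gamma> = card {i. i < dim_vec \<gamma> \<and> vec_index \<gamma> i \<noteq> 0}"

definition fourier_coeff :: "nat \<Rightarrow> (bit vec \<Rightarrow> real) \<Rightarrow> bit vec \<Rightarrow> real" where
  "fourier_coeff n f \<gamma> =
     measure_pmf.expectation (pmf_of_set (carrier_vec n))
       (\<lambda>x. f x * (-1) ^ (if scalar_prod \<gamma> x = 0 then 0 else 1))"

definition influence :: "nat \<Rightarrow> (bit vec \<Rightarrow> real) \<Rightarrow> bit vec \<Rightarrow> real" where
  "influence n f \<gamma> = measure_pmf.prob (pmf_of_set (carrier_vec n)) {x. f x \<noteq> f (x + \<gamma>)}"

text \<open>The requirement that the zeroth Fourier coefficient is below \<open>1/2\<close> in absolute value is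
  part of the notion. For a boolean \<open>f\<close>, the expectation of \<open>f x * f (x + \<gamma>)\<close> is
  \<open>1 - 2 * influence n f \<gamma>\<close>, so an error \<open>\<epsilon>\<close> in the influences is an error \<open>2 * \<epsilon>\<close>
  in the autocorrelations. This is why the regularity bound in the theorem is
  \<open>sqrt (2^(-k) + 2 * \<epsilon>)\<close>; the published bound \<open>sqrt (2^(-k) + \<epsilon>)\<close> fails with this
  definition, e.g. for \<open>n = k = 3\<close>, \<open>\<epsilon> = 0.26\<close> and a nontrivial character with its value
  flipped at one point.\<close>

definition balanced_influences :: "nat \<Rightarrow> real \<Rightarrow> nat \<Rightarrow> (bit vec \<Rightarrow> real) \<Rightarrow> bool" where
  "balanced_influences n \<epsilon> k f \<longleftrightarrow>
     \<bar>fourier_coeff n f (0\<^sub>v n)\<bar> < 1 / 2 \<and>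
     (\<forall>\<gamma> \<in> carrier_vec n. \<gamma> \<noteq> 0\<^sub>v n \<and> hamming_weight \<gamma> \<le> k \<longrightarrow>
        \<bar>influence n f \<gamma> - 1 / 2\<bar> < \<epsilon>)"

definition R_regular :: "nat \<Rightarrow> real \<Rightarrow> nat \<Rightarrow> (bit vec \<Rightarrow> real) \<Rightarrow> bool" where
  "R_regular n \<epsilon> d f \<longleftrightarrow>
     (\<forall>\<gamma> \<in> carrier_vec n. hamming_weight \<gamma> \<le> d \<longrightarrow> \<bar>fourier_coeff n f \<gamma>\<bar> < \<epsilon>)"

end

theory Submission
  imports Defs
begin

text \<open>
  Both parts rest on one inequality of van der Corput type. Let \<open>H\<close> be a subgroup of
  \<open>F_2^n\<close> and \<open>\<chi>\<close> the character of frequency \<open>\<gamma>\<close>. Averaging over the shifts in \<open>H\<close>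
  does not change the mean of \<open>f \<chi>\<close>, which is the Fourier coefficient at \<open>\<gamma>\<close>.
  By Cauchy--Schwarz its square is at most the average over \<open>h\<close> in \<open>H\<close> of
  \<open>\<chi>(h) E_x f(x) f(x + h)\<close>. The inner expectation is \<open>1 - 2 I_h[f]\<close>. The term \<open>h = 0\<close> contributes \<open>1 / |H|\<close>, and the
  other terms are small as soon as all nonzero \<open>h\<close> in \<open>H\<close> have influence near \<open>1/2\<close>
  (lemma \<open>fourier_coeff_square_bound\<close>). The subgroup used throughout is the space of vectors
  supported on the first \<open>k\<close> coordinates: it has \<open>2^k\<close> elements, all of weight at most \<open>k\<close>.

  For the first part this is immediate from balanced influences. For the second part, take the
  inner product function \<open>(-1)^(\<Sum>i<m. x_i x_(m+i))\<close> on \<open>2 m + 1\<close> variables. A nonzero shift of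
  the first \<open>m\<close> variables multiplies it by a nontrivial character of the next \<open>m\<close>, so these
  shifts have influence exactly \<open>1/2\<close>, and the same inequality bounds all Fourier coefficients
  by \<open>2^(-m/2)\<close>. The last variable is a dummy: its influence is \<open>0\<close>, which violates balance at
  every rank \<open>k \<ge> 1\<close>.
\<close>

section \<open>Vectors over the field with two elements\<close>

lemma bit_vec_add_self:
  fixes x :: "bit vec"
  assumes "x \<in> carrier_vec n"
  shows "x + x = 0\<^sub>v n"
  using assms by (intro eq_vecI) auto

lemma bit_vec_add_cancel:
  fixes x h :: "bit vec"
  assumes "x \<in> carrier_vec n" "h \<in> carrier_vec n"
  shows "(x + h) + h = x"
  using assms by (simp add: assoc_add_vec[of _ n] bit_vec_add_self[of h n])

lemma sum_bit_vec_translate: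
  fixes F :: "bit vec \<Rightarrow> 'a::comm_monoid_add"
  assumes "H \<subseteq> carrier_vec n" "\<And>x y. x \<in> H \<Longrightarrow> y \<in> H \<Longrightarrow> x + y \<in> H" "h \<in> H"
  shows "(\<Sum>x\<in>H. F (x + h)) = (\<Sum>x\<in>H. F x)"
  by (rule sum.reindex_bij_witness[of _ "\<lambda>x. x + h" "\<lambda>x. x + h"])
     (use assms in \<open>auto intro: bit_vec_add_cancel\<close>)

definition coordinate_subspace :: "nat \<Rightarrow> nat \<Rightarrow> bit vec set" where
  "coordinate_subspace n k = {h \<in> carrier_vec n. \<forall>i<n. k \<le> i \<longrightarrow> h $ i = 0}"

lemma coordinate_subspace_subset: "coordinate_subspace n k \<subseteq> carrier_vec n"
  by (auto simp: coordinate_subspace_def)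

lemma coordinate_subspace_full: "coordinate_subspace n n = carrier_vec n"
  by (auto simp: coordinate_subspace_def)

lemma coordinate_subspace_zero: "0\<^sub>v n \<in> coordinate_subspace n k"
  by (auto simp: coordinate_subspace_def)

lemma coordinate_subspace_add:
  "x \<in> coordinate_subspace n k \<Longrightarrow> y \<in> coordinate_subspace n k \<Longrightarrow> x + y \<in> coordinate_subspace n k"
  by (auto simp: coordinate_subspace_def)

lemma hamming_weight_coordinate_subspace:
  assumes "h \<in> coordinate_subspace n k"
  shows "hamming_weight h \<le> k"
proof -
  have "{i. i < dim_vec h \<and> h $ i \<noteq> 0} \<subseteq> {..<k}"
    using assms by (auto simp: coordinate_subspace_def simp flip: not_le)
  from card_mono[OF _ this] show ?thesis by (simp add: hamming_weight_def)
qed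

lemma coordinate_subspace_bij_Pow:
  assumes "k \<le> n"
  shows "bij_betw (\<lambda>S. vec n (\<lambda>i. if i \<in> S then 1 else 0)) (Pow {..<k}) (coordinate_subspace n k)"
proof (rule bij_betwI[where g = "\<lambda>h. {i. i < n \<and> h $ i = 1}"])
  show "(\<lambda>h. {i. i < n \<and> h $ i = 1}) \<in> coordinate_subspace n k \<rightarrow> Pow {..<k}"
    by (auto simp: coordinate_subspace_def simp flip: not_le)
  show "vec n (\<lambda>i. if i \<in> {i. i < n \<and> h $ i = 1} then 1 else 0) = h"
    if "h \<in> coordinate_subspace n k" for h
    using that by (intro eq_vecI) (auto simp: coordinate_subspace_def)
qed (use assms in \<open>auto simp: coordinate_subspace_def split: if_splits\<close>)

lemma card_coordinate_subspace: "k \<le> n \<Longrightarrow> card (coordinate_subspace n k) = 2 ^ k"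
  using bij_betw_same_card[OF coordinate_subspace_bij_Pow, of k n] by (simp add: card_Pow)

lemma finite_bit_carrier_vec: "finite (carrier_vec n :: bit vec set)"
  using bij_betw_finite[OF coordinate_subspace_bij_Pow[of n n]]
  by (simp add: coordinate_subspace_full)

lemma card_bit_carrier_vec_pos: "0 < card (carrier_vec n :: bit vec set)"
  using card_coordinate_subspace[of n n] by (simp add: coordinate_subspace_full)

section \<open>Signs, Fourier coefficients and influences as finite sums\<close>

definition bit_sign :: "bit \<Rightarrow> real" where
  "bit_sign b = (if b = 0 then 1 else -1)"

lemma bit_sign_add: "bit_sign (a + b) = bit_sign a * bit_sign b"
  by (cases a; cases b) (auto simp: bit_sign_def)

lemma bit_sign_square [simp]: "bit_sign b * bit_sign b = 1"
  by (simp add: bit_sign_def)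

lemma abs_bit_sign [simp]: "\<bar>bit_sign b\<bar> = 1"
  by (simp add: bit_sign_def)

lemma fourier_coeff_eq_sum:
  "fourier_coeff n f \<gamma> =
     (\<Sum>x\<in>carrier_vec n. f x * bit_sign (\<gamma> \<bullet> x)) / card (carrier_vec n :: bit vec set)"
proof -
  have "(-1::real) ^ (if \<gamma> \<bullet> x = 0 then 0 else 1) = bit_sign (\<gamma> \<bullet> x)" for x
    by (simp add: bit_sign_def)
  then show ?thesis
    unfolding fourier_coeff_def
    using finite_bit_carrier_vec[of n] card_bit_carrier_vec_pos[of n]
    by (subst integral_pmf_of_set) (auto simp: card_gt_0_iff)
qed

text \<open>A product of two signs is \<open>1 - 2 [the signs differ]\<close>, so autocorrelations and influences
  determine each other.\<close>

lemma autocorrelation_eq_influence: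
  assumes f: "boolean_function n f" and h: "h \<in> carrier_vec n"
  shows "(\<Sum>x\<in>carrier_vec n. f x * f (x + h)) =
           card (carrier_vec n :: bit vec set) * (1 - 2 * influence n f h)"
proof -
  let ?V = "carrier_vec n :: bit vec set"
  let ?D = "{x. f x \<noteq> f (x + h)}"
  have prod: "f x * f (x + h) = 1 - 2 * (if x \<in> ?D then 1 else 0)" if "x \<in> ?V" for x
  proof -
    have "f x \<in> {1, -1}" "f (x + h) \<in> {1, -1}"
      using f h that by (auto simp: boolean_function_def Pi_iff)
    then show ?thesis by auto
  qed
  have "(\<Sum>x\<in>?V. f x * f (x + h)) = (\<Sum>x\<in>?V. 1 - 2 * (if x \<in> ?D then 1 else 0))"
    by (rule sum.cong) (use prod in auto)
  also have "\<dots> = card ?V - 2 * real (card (?V \<inter> ?D))"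
    using finite_bit_carrier_vec[of n]
    by (simp add: sum_subtractf sum.If_cases flip: sum_distrib_left)
  also have "real (card (?V \<inter> ?D)) = card ?V * influence n f h"
    unfolding influence_def using finite_bit_carrier_vec[of n] card_bit_carrier_vec_pos[of n]
    by (subst measure_pmf_of_set) auto
  finally show ?thesis by (simp add: algebra_simps)
qed

section \<open>Shifting along a subgroup\<close>

text \<open>The sum of \<open>F\<close> is unchanged by every shift in \<open>H\<close>, hence equals the sum of the
  \<open>H\<close>-averages of \<open>F\<close>. Expanding the square after Cauchy--Schwarz leaves autocorrelations at
  \<open>h + h'\<close>, and every element of the group \<open>H\<close> is such a sum in \<open>|H|\<close> ways.\<close>

lemma van_der_corput_bit_vec:
  fixes F :: "bit vec \<Rightarrow> real"
  assumes H: "H \<subseteq> carrier_vec n" "H \<noteq> {}" and add: "\<And>x y. x \<in> H \<Longrightarrow> y \<in> H \<Longrightarrow> x + y \<in> H"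
  shows "card H * (\<Sum>x\<in>carrier_vec n. F x)\<^sup>2 \<le>
           card (carrier_vec n :: bit vec set) * (\<Sum>h\<in>H. \<Sum>x\<in>carrier_vec n. F x * F (x + h))"
proof -
  let ?V = "carrier_vec n :: bit vec set"
  let ?C = "\<lambda>h. \<Sum>x\<in>?V. F x * F (x + h)"
  have cardH: "0 < card H"
    using H finite_subset[OF H(1) finite_bit_carrier_vec] by (simp add: card_gt_0_iff)
  have shift: "(\<Sum>x\<in>?V. G (x + h)) = (\<Sum>x\<in>?V. G x)" if "h \<in> H" for h and G :: "bit vec \<Rightarrow> real"
    by (rule sum_bit_vec_translate) (use that H in auto)
  have pair: "(\<Sum>x\<in>?V. F (x + h) * F (x + h')) = ?C (h' + h)" if "h \<in> H" "h' \<in> H" for h h'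
  proof -
    have V: "h \<in> ?V" "h' \<in> ?V" using that H by auto
    have "(x + h) + (h' + h) = x + h'" if "x \<in> ?V" for x
      using that V by (intro eq_vecI) (auto simp: algebra_simps)
    then have "(\<Sum>x\<in>?V. F (x + h) * F (x + h')) = (\<Sum>x\<in>?V. F (x + h) * F ((x + h) + (h' + h)))"
      by simp
    also have "\<dots> = ?C (h' + h)"
      using shift[OF that(1), of "\<lambda>x. F x * F (x + (h' + h))"] .
    finally show ?thesis .
  qed
  have "card H * (\<Sum>x\<in>?V. F x) = (\<Sum>h\<in>H. \<Sum>x\<in>?V. F (x + h))"
    using shift by simp
  also have "\<dots> = (\<Sum>x\<in>?V. \<Sum>h\<in>H. F (x + h))"
    by (rule sum.swap)
  finally have "(card H * (\<Sum>x\<in>?V. F x))\<^sup>2 \<le> (\<Sum>x\<in>?V. (\<Sum>h\<in>H. F (x + h))\<^sup>2) * card ?V"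
    using sum_squared_le_sum_of_squares[of "\<lambda>x. \<Sum>h\<in>H. F (x + h)" ?V] by simp
  also have "(\<Sum>x\<in>?V. (\<Sum>h\<in>H. F (x + h))\<^sup>2) = (\<Sum>x\<in>?V. \<Sum>h\<in>H. \<Sum>h'\<in>H. F (x + h) * F (x + h'))"
    by (simp add: power2_eq_square sum_product)
  also have "\<dots> = (\<Sum>h\<in>H. \<Sum>x\<in>?V. \<Sum>h'\<in>H. F (x + h) * F (x + h'))"
    by (rule sum.swap)
  also have "\<dots> = (\<Sum>h\<in>H. \<Sum>h'\<in>H. \<Sum>x\<in>?V. F (x + h) * F (x + h'))"
    by (intro sum.cong refl sum.swap)
  also have "\<dots> = (\<Sum>h\<in>H. \<Sum>h'\<in>H. ?C (h' + h))"
    by (intro sum.cong refl pair)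
  also have "\<dots> = (\<Sum>h\<in>H. \<Sum>h'\<in>H. ?C h')"
    by (intro sum.cong refl sum_bit_vec_translate[OF H(1) add]) auto
  finally have "card H * (card H * (\<Sum>x\<in>?V. F x)\<^sup>2) \<le> card H * (card ?V * (\<Sum>h\<in>H. ?C h))"
    by (simp add: power2_eq_square mult_ac)
  then show ?thesis using cardH by simp
qed

text \<open>The inequality above is applied to \<open>f\<close> times the character of frequency \<open>\<gamma>\<close>. Its
  normalized autocorrelation at \<open>h\<close> is that of \<open>f\<close> up to a sign, so it is \<open>1\<close> for \<open>h = 0\<close>
  and at most \<open>2 \<delta>\<close> otherwise.\<close>

lemma fourier_coeff_square_bound:
  assumes f: "boolean_function n f" and k: "k \<le> n" and \<gamma>: "\<gamma> \<in> carrier_vec n"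
    and infl: "\<And>h. h \<in> coordinate_subspace n k \<Longrightarrow> h \<noteq> 0\<^sub>v n \<Longrightarrow> \<bar>influence n f h - 1 / 2\<bar> \<le> \<delta>"
  shows "(fourier_coeff n f \<gamma>)\<^sup>2 \<le> 1 / 2 ^ k + 2 * \<delta> * (1 - 1 / 2 ^ k)"
proof -
  let ?V = "carrier_vec n :: bit vec set"
  let ?H = "coordinate_subspace n k"
  define N where "N = real (card ?V)"
  define F where "F x = f x * bit_sign (\<gamma> \<bullet> x)" for x
  define C where "C h = (\<Sum>x\<in>?V. F x * F (x + h))" for h
  have N: "0 < N" using card_bit_carrier_vec_pos by (simp add: N_def)
  have HV: "h \<in> ?V" if "h \<in> ?H" for h using that coordinate_subspace_subset by auto
  have finH: "finite ?H" using finite_subset[OF coordinate_subspace_subset finite_bit_carrier_vec] .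
  have C_eq: "C h = bit_sign (\<gamma> \<bullet> h) * (N * (1 - 2 * influence n f h))" if h: "h \<in> ?V" for h
  proof -
    have "F x * F (x + h) = bit_sign (\<gamma> \<bullet> h) * (f x * f (x + h))" if "x \<in> ?V" for x
    proof -
      have "F x * F (x + h) = f x * f (x + h) * (bit_sign (\<gamma> \<bullet> x) * bit_sign (\<gamma> \<bullet> x)) * bit_sign (\<gamma> \<bullet> h)"
        using that h \<gamma> by (simp only: F_def scalar_prod_add_distrib[OF \<gamma> that h] bit_sign_add mult_ac)
      then show ?thesis by simp
    qed
    then have "C h = bit_sign (\<gamma> \<bullet> h) * (\<Sum>x\<in>?V. f x * f (x + h))"
      by (simp add: C_def sum_distrib_left)
    then show ?thesis by (simp add: autocorrelation_eq_influence[OF f h] N_def)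
  qed
  have C_nonzero: "C h \<le> N * (2 * \<delta>)" if "h \<in> ?H - {0\<^sub>v n}" for h
  proof -
    have "C h \<le> \<bar>C h\<bar>" by simp
    also have "\<dots> = N * \<bar>1 - 2 * influence n f h\<bar>"
      using that HV N by (simp add: C_eq abs_mult)
    also have "\<dots> \<le> N * (2 * \<delta>)"
      using infl[of h] that N by (intro mult_left_mono) auto
    finally show ?thesis .
  qed
  have C_zero: "C (0\<^sub>v n) = N"
  proof -
    have "F x * F (x + 0\<^sub>v n) = 1" if "x \<in> ?V" for x
      using f that by (auto simp: F_def boolean_function_def Pi_iff bit_sign_def)
    then show ?thesis by (simp add: C_def N_def)
  qed
  have "(\<Sum>h\<in>?H. C h) = C (0\<^sub>v n) + (\<Sum>h\<in>?H - {0\<^sub>v n}. C h)"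
    by (rule sum.remove[OF finH coordinate_subspace_zero])
  also have "\<dots> \<le> N + (2 ^ k - 1) * (N * (2 * \<delta>))"
    using sum_bounded_above[of "?H - {0\<^sub>v n}" C, OF C_nonzero]
    by (simp add: C_zero card_Diff_singleton[OF coordinate_subspace_zero]
          card_coordinate_subspace[OF k] of_nat_diff)
  finally have sumC: "(\<Sum>h\<in>?H. C h) \<le> N * (1 + (2 ^ k - 1) * (2 * \<delta>))"
    by (simp add: algebra_simps)
  have "2 ^ k * (\<Sum>x\<in>?V. F x)\<^sup>2 \<le> N * (\<Sum>h\<in>?H. C h)"
    using van_der_corput_bit_vec[OF coordinate_subspace_subset _ coordinate_subspace_add, of n k F]
      coordinate_subspace_zero[of n k] card_coordinate_subspace[OF k]
    by (auto simp: C_def N_def)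
  also have "\<dots> \<le> N * (N * (1 + (2 ^ k - 1) * (2 * \<delta>)))"
    using sumC N by (intro mult_left_mono) auto
  finally have "2 ^ k * (\<Sum>x\<in>?V. F x)\<^sup>2 \<le> N\<^sup>2 * (1 + (2 ^ k - 1) * (2 * \<delta>))"
    by (simp add: power2_eq_square mult_ac)
  moreover have "fourier_coeff n f \<gamma> = (\<Sum>x\<in>?V. F x) / N"
    by (simp add: fourier_coeff_eq_sum F_def N_def)
  ultimately have "2 ^ k * (fourier_coeff n f \<gamma>)\<^sup>2 \<le> 1 + (2 ^ k - 1) * (2 * \<delta>)"
    using N by (simp add: power_divide pos_divide_le_eq mult.commute)
  then show ?thesis by (simp add: field_simps)
qed

lemma balanced_influences_imp_R_regular:
  assumes f: "boolean_function n f" and \<epsilon>: "0 < \<epsilon>" and k: "k \<le> n"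
    and bal: "balanced_influences n \<epsilon> k f"
  shows "R_regular n (sqrt (2 powr (- real k) + 2 * \<epsilon>)) n f"
  unfolding R_regular_def
proof (intro ballI impI)
  fix \<gamma> :: "bit vec" assume \<gamma>: "\<gamma> \<in> carrier_vec n"
  have "\<bar>influence n f h - 1 / 2\<bar> \<le> \<epsilon>" if "h \<in> coordinate_subspace n k" "h \<noteq> 0\<^sub>v n" for h
    using bal that coordinate_subspace_subset hamming_weight_coordinate_subspace[OF that(1)]
    unfolding balanced_influences_def by (meson less_imp_le subsetD)
  then have "(fourier_coeff n f \<gamma>)\<^sup>2 \<le> 1 / 2 ^ k + 2 * \<epsilon> * (1 - 1 / 2 ^ k)"
    using fourier_coeff_square_bound[OF f k \<gamma>] by blast
  \<comment> \<open>The inequality becomes strict because the shift \<open>0\<close> does not carry an error \<open>2 \<epsilon>\<close>.\<close>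
  also have "\<dots> < 1 / 2 ^ k + 2 * \<epsilon>"
    using \<epsilon> by (simp add: algebra_simps)
  also have "1 / 2 ^ k = 2 powr (- real k)"
    by (simp add: powr_minus powr_realpow field_simps)
  finally show "\<bar>fourier_coeff n f \<gamma>\<bar> < sqrt (2 powr (- real k) + 2 * \<epsilon>)"
    using real_sqrt_less_mono by fastforce
qed

section \<open>The inner product function\<close>

definition inner_product_sign :: "nat \<Rightarrow> bit vec \<Rightarrow> real" where
  "inner_product_sign m x = bit_sign (\<Sum>i<m. x $ i * x $ (m + i))"

lemma boolean_function_inner_product_sign: "boolean_function n (inner_product_sign m)"
  by (auto simp: boolean_function_def inner_product_sign_def bit_sign_def)

text \<open>Shifting the first block by \<open>h\<close> multiplies the function by a character of the second block.
  If \<open>h\<close> is nonzero at position \<open>i\<close>, this character changes sign when position \<open>m + i\<close> is flipped,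
  so the autocorrelation equals its own negative.\<close>

lemma influence_inner_product_sign:
  assumes n: "2 * m \<le> n" and h: "h \<in> coordinate_subspace n m" "h \<noteq> 0\<^sub>v n"
  shows "influence n (inner_product_sign m) h = 1 / 2"
proof -
  let ?V = "carrier_vec n :: bit vec set"
  let ?f = "inner_product_sign m"
  define \<psi> where "\<psi> x = bit_sign (\<Sum>i<m. h $ i * x $ (m + i))" for x :: "bit vec"
  have hV: "h \<in> ?V" and h0: "\<And>i. i < n \<Longrightarrow> m \<le> i \<Longrightarrow> h $ i = 0"
    using h(1) by (auto simp: coordinate_subspace_def)
  obtain j where j: "j < m" "h $ j = 1"
  proof -
    obtain j where "j < n" "h $ j \<noteq> 0"
      using h(2) hV by (metis carrier_vecD eq_vecI index_zero_vec)
    moreover from this have "h $ j = 1" by (cases "h $ j") auto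
    ultimately show thesis using h0 that by (metis not_le)
  qed
  have prod: "?f x * ?f (x + h) = \<psi> x" if x: "x \<in> ?V" for x
  proof -
    have "(x + h) $ i * (x + h) $ (m + i) = x $ i * x $ (m + i) + h $ i * x $ (m + i)"
      if "i < m" for i
    proof -
      have "(x + h) $ i = x $ i + h $ i" "(x + h) $ (m + i) = x $ (m + i)"
        using that x hV n h0[of "m + i"] by simp_all
      then show ?thesis by (simp only: distrib_right)
    qed
    then have "(\<Sum>i<m. (x + h) $ i * (x + h) $ (m + i))
                 = (\<Sum>i<m. x $ i * x $ (m + i) + h $ i * x $ (m + i))"
      by (intro sum.cong refl) (simp only: lessThan_iff)
    then have "?f (x + h) = ?f x * \<psi> x"
      by (simp only: inner_product_sign_def \<psi>_def sum.distrib bit_sign_add)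
    then show ?thesis by (simp add: inner_product_sign_def flip: mult.assoc)
  qed
  have flip: "\<psi> (x + unit_vec n (m + j)) = - \<psi> x" if x: "x \<in> ?V" for x
  proof -
    have "h $ i * (x + unit_vec n (m + j)) $ (m + i)
            = h $ i * x $ (m + i) + (if i = j then h $ i else 0)" if "i < m" for i
    proof -
      have "(x + unit_vec n (m + j)) $ (m + i) = x $ (m + i) + (if i = j then 1 else 0)"
        using that x n j(1) by (simp add: unit_vec_def)
      then show ?thesis
        by (cases "i = j")
           (simp_all only: distrib_left simp_thms if_True if_False mult_1_right mult_zero_right)
    qed
    then have "(\<Sum>i<m. h $ i * (x + unit_vec n (m + j)) $ (m + i))
                 = (\<Sum>i<m. h $ i * x $ (m + i) + (if i = j then h $ i else 0))"
      by (intro sum.cong refl) (simp only: lessThan_iff)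
    moreover have "(\<Sum>i<m. if i = j then h $ i else 0) = h $ j"
      using j(1) by (subst sum.delta) auto
    ultimately have "\<psi> (x + unit_vec n (m + j)) = \<psi> x * bit_sign (h $ j)"
      by (simp only: \<psi>_def sum.distrib bit_sign_add)
    then show ?thesis by (simp add: j bit_sign_def)
  qed
  have "(\<Sum>x\<in>?V. \<psi> x) = (\<Sum>x\<in>?V. \<psi> (x + unit_vec n (m + j)))"
    by (rule sum_bit_vec_translate[symmetric]) auto
  also have "\<dots> = - (\<Sum>x\<in>?V. \<psi> x)"
    by (simp add: flip sum_negf)
  finally have "(\<Sum>x\<in>?V. \<psi> x) = 0" by simp
  then have "(\<Sum>x\<in>?V. ?f x * ?f (x + h)) = 0"
    by (simp add: prod)
  then show ?thesis
    using autocorrelation_eq_influence[OF boolean_function_inner_product_sign hV, of m]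
      card_bit_carrier_vec_pos[of n] by simp
qed

lemma R_regular_inner_product_sign:
  assumes n: "2 * m \<le> n" and \<epsilon>: "0 < \<epsilon>" "1 / 2 ^ m < \<epsilon>\<^sup>2"
  shows "R_regular n \<epsilon> d (inner_product_sign m)"
  unfolding R_regular_def
proof (intro ballI impI)
  fix \<gamma> :: "bit vec" assume "\<gamma> \<in> carrier_vec n"
  then have "(fourier_coeff n (inner_product_sign m) \<gamma>)\<^sup>2 \<le> 1 / 2 ^ m + 2 * 0 * (1 - 1 / 2 ^ m)"
    using n influence_inner_product_sign[OF n]
    by (intro fourier_coeff_square_bound boolean_function_inner_product_sign) auto
  then have "\<bar>fourier_coeff n (inner_product_sign m) \<gamma>\<bar>\<^sup>2 < \<epsilon>\<^sup>2"
    using \<epsilon> by simp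
  then show "\<bar>fourier_coeff n (inner_product_sign m) \<gamma>\<bar> < \<epsilon>"
    by (rule power_less_imp_less_base) (use \<epsilon>(1) in simp)
qed

lemma hamming_weight_unit_vec: "j < n \<Longrightarrow> hamming_weight (unit_vec n j) = 1"
proof -
  assume "j < n"
  then have "{i. i < dim_vec (unit_vec n j :: bit vec) \<and> (unit_vec n j :: bit vec) $ i \<noteq> 0} = {j}"
    by (auto simp: unit_vec_def split: if_splits)
  then show ?thesis by (simp add: hamming_weight_def)
qed

lemma influence_dummy_variable:
  assumes "2 * m \<le> j" "j < n"
  shows "influence n (inner_product_sign m) (unit_vec n j) = 0"
proof -
  have "inner_product_sign m (x + unit_vec n j) = inner_product_sign m x"
    if "x \<in> carrier_vec n" for x
    unfolding inner_product_sign_def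
    by (intro arg_cong[of _ _ bit_sign] sum.cong) (use that assms in \<open>auto simp: unit_vec_def\<close>)
  then have "carrier_vec n \<inter> {x. inner_product_sign m x \<noteq> inner_product_sign m (x + unit_vec n j)} = {}"
    by auto
  then show ?thesis
    unfolding influence_def using finite_bit_carrier_vec[of n] card_bit_carrier_vec_pos[of n]
    by (subst measure_pmf_of_set) (auto simp: card_gt_0_iff)
qed

lemma not_balanced_influences_dummy_variable:
  assumes "2 * m < n" "1 \<le> k" "\<epsilon> < 1 / 2"
  shows "\<not> balanced_influences n \<epsilon> k (inner_product_sign m)"
proof
  assume bal: "balanced_influences n \<epsilon> k (inner_product_sign m)"
  have "unit_vec n (2 * m) \<noteq> (0\<^sub>v n :: bit vec)"
    using assms(1) by (metis index_unit_vec(2) index_zero_vec(1) zero_neq_one)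
  then have "\<bar>influence n (inner_product_sign m) (unit_vec n (2 * m)) - 1 / 2\<bar> < \<epsilon>"
    using bal assms hamming_weight_unit_vec[of "2 * m" n] by (auto simp: balanced_influences_def)
  then show False
    using influence_dummy_variable[of m "2 * m" n] assms by simp
qed

section \<open>Balanced influences and regularity\<close>

theorem theorem4p3:
  shows "(\<forall>n k \<epsilon> f. boolean_function n f \<and> 0 < \<epsilon> \<and> k \<le> n \<and> balanced_influences n \<epsilon> k f
            \<longrightarrow> R_regular n (sqrt (2 powr (- real k) + 2 * \<epsilon>)) n f)
       \<and> (\<forall>\<epsilon>>0. \<exists>n f. boolean_function n f \<and> R_regular n \<epsilon> n f \<and>
            (\<forall>k\<ge>1. \<forall>\<epsilon>'<1/2. \<not> balanced_influences n \<epsilon>' k f))"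
proof (intro conjI allI impI)
  fix \<epsilon> :: real assume \<epsilon>: "0 < \<epsilon>"
  obtain m where "(1 / 2) ^ m < \<epsilon>\<^sup>2"
    using real_arch_pow_inv[of "\<epsilon>\<^sup>2" "1 / 2"] \<epsilon> by auto
  then have m: "1 / 2 ^ m < \<epsilon>\<^sup>2"
    by (simp add: power_one_over)
  show "\<exists>n f. boolean_function n f \<and> R_regular n \<epsilon> n f \<and>
          (\<forall>k\<ge>1. \<forall>\<epsilon>'<1/2. \<not> balanced_influences n \<epsilon>' k f)"
    by (rule exI[of _ "2 * m + 1"], rule exI[of _ "inner_product_sign m"])
       (use \<epsilon> m in \<open>simp add: boolean_function_inner_product_sign R_regular_inner_product_sign
          not_balanced_influences_dummy_variable\<close>)
qed (use balanced_influences_imp_R_regular in auto)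

end
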